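(* Let $\beta\ge1$ be an integer dividing $N$ and let $B=N/\beta$. Consider a Gabor multiplier $\mathsf{G}^{g_1,g_2}_a$ with no time subsampling (i.e. $\alpha=1$) and frequency lattice constant $\beta$, with windows $g_1,g_2\in\mathbb{C}^N$, $g_1$ symmetric, and symbol $a=\mathbf{1}\otimes\hat h$ for some $\hat h\in\mathbb{C}^N$. Then it is also an LTI filter, with impulse response $$u\mapsto\frac{1}{\beta}\sum_{k=0}^{\beta-1}h(u+Bk)\,(\overline{g_1}\ast g_2)(u),\qquad u=0,\dots,N-1,$$ where $h=\mathcal{F}_N^{-1}\hat h$.
   Context: $\mathbb{C}^N$ is identified with $\ell^2(\mathbb{Z}_N)$, and all indices are taken modulo $N$. For $f,g\in\mathbb{C}^N$: $T_kf(t)=f(t-k)$, $M_lf(t)=e^{2\pi i lt/N}f(t)$, $\pi(k,l)=M_lT_k$, $(f\ast g)(u)=\sum_{k=0}^{N-1}f(u-k)g(k)$, $(f\otimes g)(u,v)=f(u)g(v)$; $\mathbf{1}\in\mathbb{C}^N$ is the constant vector equal to $1$; $g_1$ symmetric means $g_1(-t)=g_1(t)$ for all $t$. The discrete Fourier transform is $\mathcal{F}_Nf(v)=\hat f(v)=\sum_{k=0}^{N-1}f(k)e^{-2\pi i kv/N}$, with inverse $\mathcal{F}_N^{-1}f(v)=\frac1N\sum_{k=0}^{N-1}f(k)e^{2\pi i kv/N}$. The short-time Fourier transform is $V_gf(u,v)=\sum_{k=0}^{N-1}f(k)\overline{g(k-u)}e^{-2\pi i kv/N}$. An LTI (linear time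 invariant) filter with impulse response $c\in\mathbb{C}^N$ is the operator $f\mapsto c\ast f$. The Gabor multiplier with time lattice constant $\alpha=1$, frequency lattice constant $\beta$, windows $g_1,g_2$ and symbol $a\in\mathbb{C}^{N\times N}$ is $\mathsf{G}^{g_1,g_2}_af=\sum_{k=0}^{N-1}\sum_{l=0}^{B-1}a(k,\beta l)\,V_{g_1}f(k,\beta l)\,\pi(k,\beta l)g_2$.
   Formalization: The impulse response carries an extra factor N, i.e. (N/β)·Σ h(u+Bk)·(conj(g1)∗g2)(u); with the stated normalisations the printed formula is off by N (N=2, β=1, all vectors constant 1 gives 4 instead of 2). *)

theory Defs
  imports Complex_Main
begin

(* C^N = l^2(Z_N) is rendered as the set of N-periodic functions on the integers, so that every
   index is automatically read modulo N. *)
definition signals :: "nat \<Rightarrow> (int \<Rightarrow> complex) set" where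
  "signals N = {f. \<forall>t. f (t + int N) = f t}"

definition symmetric_signal :: "(int \<Rightarrow> complex) \<Rightarrow> bool" where
  "symmetric_signal g \<longleftrightarrow> (\<forall>t. g (- t) = g t)"

definition translate :: "int \<Rightarrow> (int \<Rightarrow> complex) \<Rightarrow> int \<Rightarrow> complex" where
  "translate k f t = f (t - k)"

definition modulate :: "nat \<Rightarrow> int \<Rightarrow> (int \<Rightarrow> complex) \<Rightarrow> int \<Rightarrow> complex" where
  "modulate N l f t = cis (2 * pi * of_int (l * t) / of_nat N) * f t"

definition tf_shift :: "nat \<Rightarrow> int \<Rightarrow> int \<Rightarrow> (int \<Rightarrow> complex) \<Rightarrow> int \<Rightarrow> complex" where
  "tf_shift N k l f = modulate N l (translate k f)"

definition convolve :: "nat \<Rightarrow> (int \<Rightarrow> complex) \<Rightarrow> (int \<Rightarrow> complex) \<Rightarrow> int \<Rightarrow> complex" where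
  "convolve N f g u = (\<Sum>k<N. f (u - int k) * g (int k))"

definition tensor :: "(int \<Rightarrow> complex) \<Rightarrow> (int \<Rightarrow> complex) \<Rightarrow> int \<Rightarrow> int \<Rightarrow> complex" where
  "tensor f g u v = f u * g v"

(* The factor 1/N sits here, while stft and gabor_multiplier are unnormalised. With these
   conventions the impulse response of the multiplier with symbol 1 (x) h_hat carries a factor N
   on top of (1/\<beta>) * sum_k h(u + B k) * (conj g1 * g2)(u); the theorem states that factor. *)
definition inverse_dft :: "nat \<Rightarrow> (int \<Rightarrow> complex) \<Rightarrow> int \<Rightarrow> complex" where
  "inverse_dft N f v =
     1 / of_nat N * (\<Sum>k<N. f (int k) * cis (2 * pi * of_int (int k * v) / of_nat N))"

definition stft :: "nat \<Rightarrow> (int \<Rightarrow> complex) \<Rightarrow> (int \<Rightarrow> complex) \<Rightarrow> int \<Rightarrow> int \<Rightarrow> complex" where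
  "stft N g f u v =
     (\<Sum>k<N. f (int k) * cnj (g (int k - u)) * cis (- (2 * pi * of_int (int k * v) / of_nat N)))"

(* Time lattice constant 1, frequency lattice constant \<beta>; only meant for \<beta> dividing N. *)
definition gabor_multiplier ::
  "nat \<Rightarrow> nat \<Rightarrow> (int \<Rightarrow> complex) \<Rightarrow> (int \<Rightarrow> complex) \<Rightarrow> (int \<Rightarrow> int \<Rightarrow> complex) \<Rightarrow>
   (int \<Rightarrow> complex) \<Rightarrow> int \<Rightarrow> complex" where
  "gabor_multiplier N \<beta> g1 g2 a f t =
     (\<Sum>k<N. \<Sum>l<N div \<beta>.
        a (int k) (int (\<beta> * l)) * stft N g1 f (int k) (int (\<beta> * l)) *
        tf_shift N (int k) (int (\<beta> * l)) g2 t)"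

definition is_LTI_filter ::
  "nat \<Rightarrow> (int \<Rightarrow> complex) \<Rightarrow> ((int \<Rightarrow> complex) \<Rightarrow> int \<Rightarrow> complex) \<Rightarrow> bool" where
  "is_LTI_filter N c T \<longleftrightarrow> c \<in> signals N \<and> (\<forall>f\<in>signals N. T f = convolve N c f)"

end

theory Submission
  imports Defs
begin

text \<open>
  Expanding the short-time Fourier transform writes the multiplier as the integral operator with
  kernel \<open>(\<Sum>l. h_hat (\<beta> l) e (\<beta> l (t - m)))\<close> times \<open>(\<Sum>k. cnj (g1 (m - k)) g2 (t - k))\<close>. By
  symmetry of \<open>g1\<close> the second factor is the convolution of \<open>cnj g1\<close> and \<open>g2\<close> at \<open>t - m\<close>, and the
  first is \<open>B\<close> times the \<open>B\<close>-periodization of \<open>h\<close> by Poisson summation on the cyclic group, that is, by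
  orthogonality of the characters of the subgroup generated by \<open>B\<close>.
\<close>

definition character :: "nat \<Rightarrow> int \<Rightarrow> complex" where
  "character N x = cis (2 * pi * of_int x / of_nat N)"

lemma character_add: "character N (x + y) = character N x * character N y"
  by (simp add: character_def cis_mult add_divide_distrib distrib_left)

lemma character_power: "character N x ^ k = character N (int k * x)"
  by (simp add: character_def Complex.DeMoivre mult_ac)

lemma character_mult_period [simp]:
  assumes "N \<ge> 1"
  shows "character N (int N * x) = 1" "character N (x * int N) = 1"
  using cis_multiple_2pi[of "of_int x"] assms by (simp_all add: character_def mult.assoc)

lemma character_eq_1_iff:
  assumes "N \<ge> 1"
  shows "character N x = 1 \<longleftrightarrow> int N dvd x"
proof
  assume "character N x = 1"
  then have "cos (2 * pi * of_int x / of_nat N) = 1"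
    by (simp add: character_def complex_eq_iff)
  then obtain k :: int where "2 * pi * of_int x / of_nat N = of_int k * 2 * pi"
    using cos_one_2pi_int by blast
  then have "real_of_int x = of_int (k * int N)"
    using assms by (simp add: field_simps)
  then show "int N dvd x"
    by (metis dvd_triv_right of_int_eq_iff)
qed (use assms in auto)

text \<open>On multiples of \<open>B\<close>, the character modulo \<open>\<beta> * B\<close> is a
  character modulo \<open>\<beta>\<close>. This reduces orthogonality on the subgroup generated by
  \<open>B\<close> to \<open>sum_character\<close> with modulus \<open>\<beta>\<close>.\<close>

lemma character_mult_cancel:
  assumes "\<beta> \<ge> 1" "B \<ge> 1"
  shows "character (\<beta> * B) (int B * x) = character \<beta> x"
  using assms by (simp add: character_def mult.assoc)

text \<open>A geometric sum whose ratio \<open>character N x\<close> is an \<open>N\<close>-th root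
  of unity: it vanishes unless the ratio is 1, and then all \<open>N\<close> terms are 1.\<close>

lemma sum_character:
  assumes "N \<ge> 1"
  shows "(\<Sum>k<N. character N (int k * x)) = (if int N dvd x then of_nat N else 0)"
proof -
  have eq: "(\<Sum>k<N. character N (int k * x)) = (\<Sum>k<N. character N x ^ k)"
    by (simp add: character_power)
  show ?thesis
  proof (cases "character N x = 1")
    case True
    then have "int N dvd x"
      using assms by (simp add: character_eq_1_iff)
    then show ?thesis by (simp add: eq True)
  next
    case False
    moreover have "character N x ^ N = 1"
      using assms by (simp add: character_power)
    ultimately show ?thesis
      using assms by (simp add: eq geometric_sum character_eq_1_iff)
  qed
qed

lemma inverse_dft_character:
  "inverse_dft N f v = 1 / of_nat N * (\<Sum>k<N. f (int k) * character N (int k * v))"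
  by (simp add: inverse_dft_def character_def)

lemma signals_mod:
  assumes "f \<in> signals N"
  shows "f (x mod int N) = f x"
proof -
  have step: "f (t + int N) = f t" for t
    using assms by (simp add: signals_def)
  have "f (t + int N * k) = f t" for t k
  proof (induction k rule: int_induct[where k = 0])
    case (step1 i)
    then show ?case using step[of "t + int N * i"] by (simp add: algebra_simps)
  next
    case (step2 i)
    then show ?case using step[of "t + int N * (i - 1)"] by (simp add: algebra_simps)
  qed simp
  from this[of "x mod int N" "x div int N"] show ?thesis
    by simp
qed

text \<open>The map \<open>k \<mapsto> (t - k) mod N\<close> is an involution of the residues below
  \<open>N\<close>, so it serves as its own inverse in the reindexing.\<close>

lemma sum_signals_reflect:
  assumes "N \<ge> 1" and f: "f \<in> signals N"
  shows "(\<Sum>k<N. f (t - int k)) = (\<Sum>k<N. f (int k))"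
proof (rule sum.reindex_bij_witness[where i = "\<lambda>k. nat ((t - int k) mod int N)"
      and j = "\<lambda>k. nat ((t - int k) mod int N)"])
  fix k assume "k \<in> {..<N}"
  then have k: "k < N" by simp
  have nonneg: "0 \<le> (t - int k) mod int N" and lt: "(t - int k) mod int N < int N"
    using assms by simp_all
  have "(t - (t - int k) mod int N) mod int N = int k"
    using k by (simp add: mod_simps)
  then show "nat ((t - int (nat ((t - int k) mod int N))) mod int N) = k"
    using nonneg by simp
  then show "nat ((t - int (nat ((t - int k) mod int N))) mod int N) = k" .
  show "nat ((t - int k) mod int N) \<in> {..<N}"
    using nonneg lt by simp
  then show "nat ((t - int k) mod int N) \<in> {..<N}" .
  show "f (int (nat ((t - int k) mod int N))) = f (t - int k)"
    using nonneg signals_mod[OF f] by simp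
qed

lemma convolve_signals:
  assumes "f \<in> signals N"
  shows "convolve N f g \<in> signals N"
proof -
  have "f (t + int N - x) = f (t - x)" for t x
    using assms unfolding signals_def by (metis (mono_tags, lifting) add_diff_eq diff_add_eq mem_Collect_eq)
  then show ?thesis
    by (simp add: signals_def convolve_def)
qed

lemma inverse_dft_signals:
  assumes "N \<ge> 1"
  shows "inverse_dft N f \<in> signals N"
  using assms by (simp add: signals_def inverse_dft_character distrib_left character_add)

text \<open>Expand \<open>inverse_dft\<close> and sum over \<open>k\<close> first: only frequencies
  divisible by \<open>\<beta>\<close> survive. The factor \<open>\<beta> * B\<close> cancels the
  normalisation of \<open>inverse_dft\<close>, and \<open>1 / \<beta>\<close> cancels the value of
  the character sum.\<close>

lemma periodized_inverse_dft:
  assumes "\<beta> \<ge> 1" "B \<ge> 1"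
  shows "of_nat (\<beta> * B) * (1 / of_nat \<beta> * (\<Sum>k<\<beta>. inverse_dft (\<beta> * B) f (u + int (B * k)))) =
    (\<Sum>l<B. f (int (\<beta> * l)) * character (\<beta> * B) (int (\<beta> * l) * u))"
proof -
  let ?N = "\<beta> * B"
  let ?e = "character ?N"
  have orth: "(\<Sum>k<\<beta>. ?e (int n * int (B * k))) = (if \<beta> dvd n then of_nat \<beta> else 0)" for n
  proof -
    have "?e (int n * int (B * k)) = character \<beta> (int k * int n)" for k
      using character_mult_cancel[OF assms, of "int k * int n"] by (simp add: mult_ac)
    then show ?thesis
      using assms by (simp add: sum_character)
  qed
  have "of_nat ?N * (1 / of_nat \<beta> * (\<Sum>k<\<beta>. inverse_dft ?N f (u + int (B * k)))) =
      1 / of_nat \<beta> * (\<Sum>k<\<beta>. \<Sum>n<?N. f (int n) * ?e (int n * u) * ?e (int n * int (B * k)))"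
    using assms
    by (simp add: inverse_dft_character character_add distrib_left mult.assoc
        sum_divide_distrib[symmetric])
  also have "\<dots> = 1 / of_nat \<beta> *
      (\<Sum>n<?N. f (int n) * ?e (int n * u) * (\<Sum>k<\<beta>. ?e (int n * int (B * k))))"
    by (subst sum.swap) (simp add: sum_distrib_left)
  also have "\<dots> = (\<Sum>n<?N. if \<beta> dvd n then f (int n) * ?e (int n * u) else 0)"
    unfolding orth sum_distrib_left using assms by (intro sum.cong) auto
  also have "\<dots> = (\<Sum>n\<in>{n\<in>{..<?N}. \<beta> dvd n}. f (int n) * ?e (int n * u))"
    by (rule sum.inter_filter[symmetric]) simp
  \<comment> \<open>The multiples of \<open>\<beta>\<close> below \<open>\<beta> * B\<close> are
    exactly \<open>\<beta> * l\<close> with \<open>l < B\<close>.\<close>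
  also have "\<dots> = (\<Sum>l<B. f (int (\<beta> * l)) * ?e (int (\<beta> * l) * u))"
    using assms
    by (intro sum.reindex_bij_witness[where i = "\<lambda>l. \<beta> * l" and j = "\<lambda>n. n div \<beta>"])
      (auto elim!: dvdE)
  finally show ?thesis .
qed

lemma sum_window_product:
  assumes "N \<ge> 1" "g1 \<in> signals N" "g2 \<in> signals N" "symmetric_signal g1"
  shows "(\<Sum>k<N. cnj (g1 (m - int k)) * g2 (t - int k)) = convolve N (\<lambda>t. cnj (g1 t)) g2 (t - m)"
proof -
  let ?p = "\<lambda>j. cnj (g1 (t - m - j)) * g2 j"
  have "g1 (t - m - (j + int N)) = g1 (t - m - j)" for j
  proof -
    have "g1 ((t - m - j - int N) + int N) = g1 (t - m - j - int N)"
      using assms(2) unfolding signals_def by blast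
    then show ?thesis by (simp add: algebra_simps)
  qed
  then have p: "?p \<in> signals N"
    using assms(3) by (simp add: signals_def)
  \<comment> \<open>Symmetry enters here: the argument on the right is \<open>k - m\<close>. It
    turns the correlation of the windows into a convolution after the substitution
    \<open>j = t - k\<close>.\<close>
  have "g1 (m - int k) = g1 (t - m - (t - int k))" for k
  proof -
    have "g1 (- (m - int k)) = g1 (m - int k)"
      using assms(4) unfolding symmetric_signal_def by blast
    then show ?thesis by simp
  qed
  then have "(\<Sum>k<N. cnj (g1 (m - int k)) * g2 (t - int k)) = (\<Sum>k<N. ?p (t - int k))"
    by simp
  also have "\<dots> = (\<Sum>k<N. ?p (int k))"
    by (rule sum_signals_reflect[OF assms(1) p])
  finally show ?thesis
    by (simp add: convolve_def)
qed

text \<open>The symbol is constant in time, so the time index \<open>k\<close> occurs only in the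
  windows and the frequency index \<open>l\<close> only in the symbol and the phase. Hence the
  kernel factors.\<close>

lemma gabor_multiplier_kernel:
  "gabor_multiplier N \<beta> g1 g2 (tensor (\<lambda>_. 1) a) f t =
    (\<Sum>m<N. (\<Sum>l<N div \<beta>. a (int (\<beta> * l)) * character N (int (\<beta> * l) * (t - int m))) *
      (\<Sum>k<N. cnj (g1 (int m - int k)) * g2 (t - int k)) * f (int m))"
proof -
  let ?F = "\<lambda>k l m. a (int (\<beta> * l)) * character N (int (\<beta> * l) * (t - int m)) *
      (cnj (g1 (int m - int k)) * g2 (t - int k)) * f (int m)"
  \<comment> \<open>The analysis phase at \<open>m\<close> and the synthesis phase at
    \<open>t\<close> merge into a character of \<open>t - m\<close>, the source of translation
    invariance.\<close>
  have char: "cis (- (2 * pi * of_int (int m * v) / of_nat N)) * cis (2 * pi * of_int (v * t) / of_nat N)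
      = character N (v * (t - int m))" for m v
    by (simp add: character_def cis_mult diff_divide_distrib algebra_simps)
  have "gabor_multiplier N \<beta> g1 g2 (tensor (\<lambda>_. 1) a) f t =
      (\<Sum>k<N. \<Sum>l<N div \<beta>. \<Sum>m<N. ?F k l m)"
    unfolding gabor_multiplier_def stft_def tf_shift_def modulate_def translate_def tensor_def
      char[symmetric] sum_distrib_left sum_distrib_right
    by (intro sum.cong refl) (simp only: mult_ac mult_1_left)
  \<comment> \<open>Three exchanges bring \<open>m\<close> outermost and \<open>k\<close> innermost,
    the shape in which \<open>sum_product\<close> splits off the two factors.\<close>
  also have "\<dots> = (\<Sum>k<N. \<Sum>m<N. \<Sum>l<N div \<beta>. ?F k l m)"
    by (intro sum.cong refl sum.swap)
  also have "\<dots> = (\<Sum>m<N. \<Sum>k<N. \<Sum>l<N div \<beta>. ?F k l m)"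
    by (rule sum.swap)
  also have "\<dots> = (\<Sum>m<N. \<Sum>l<N div \<beta>. \<Sum>k<N. ?F k l m)"
    by (intro sum.cong refl sum.swap)
  finally show ?thesis
    unfolding sum_product by (simp only: sum_distrib_right)
qed

theorem theorem6p9:
  fixes N \<beta> B :: nat and g1 g2 h_hat h :: "int \<Rightarrow> complex"
  assumes "N \<ge> 1" and "\<beta> \<ge> 1" and "\<beta> dvd N" and "B = N div \<beta>"
    and "g1 \<in> signals N" and "g2 \<in> signals N" and "symmetric_signal g1"
    and "h_hat \<in> signals N" and "h = inverse_dft N h_hat"
  shows "is_LTI_filter N
     (\<lambda>u. of_nat N *
        (1 / of_nat \<beta> * (\<Sum>k<\<beta>. h (u + int (B * k)) * convolve N (\<lambda>t. cnj (g1 t)) g2 u)))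
     (gabor_multiplier N \<beta> g1 g2 (tensor (\<lambda>_. 1) h_hat))"
proof -
  let ?w = "convolve N (\<lambda>t. cnj (g1 t)) g2"
  let ?c = "\<lambda>u. of_nat N * (1 / of_nat \<beta> * (\<Sum>k<\<beta>. h (u + int (B * k)) * ?w u))"
  have N: "N = \<beta> * B"
    using assms by simp
  have B: "B \<ge> 1"
    using N assms(1) by (cases B) auto
  have "?w \<in> signals N"
    using assms(5) by (intro convolve_signals) (simp add: signals_def)
  then have w: "?w (u + int N) = ?w u" for u
    by (simp add: signals_def)
  have "h \<in> signals N"
    using assms by (simp add: inverse_dft_signals)
  then have "h ((u + x) + int N) = h (u + x)" for u x
    unfolding signals_def by blast
  then have h: "h (u + int N + x) = h (u + x)" for u x
    by (metis add.assoc add.commute)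
  \<comment> \<open>The window factor does not depend on \<open>k\<close> and leaves the sum; the
    periodization of \<open>h\<close> is then traded for the sum over \<open>l\<close> in the
    kernel.\<close>
  have c: "?c u = (\<Sum>l<N div \<beta>. h_hat (int (\<beta> * l)) * character N (int (\<beta> * l) * u)) * ?w u" for u
    unfolding periodized_inverse_dft[OF assms(2) B, of h_hat u, folded N, folded assms(4,9), symmetric]
      assms(4)[symmetric] by (simp add: sum_distrib_right[symmetric])
  have "gabor_multiplier N \<beta> g1 g2 (tensor (\<lambda>_. 1) h_hat) f = convolve N ?c f" for f
    unfolding convolve_def[of N ?c]
    by (rule ext) (simp only: c gabor_multiplier_kernel sum_window_product[OF assms(1,5,6,7)])
  \<comment> \<open>An impulse response must itself be \<open>N\<close>-periodic; both factors of
    \<open>?c\<close> are.\<close>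
  moreover have "?c \<in> signals N"
    by (simp add: signals_def h w)
  ultimately show ?thesis
    by (simp add: is_LTI_filter_def)
qed

end
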